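(* Let $G=(V,E)$ be a finite multigraph with edge weights $\boldsymbol\beta=(\beta_e)$ and all vertex weights equal to $\gamma$. Then $$\Theta_G(\boldsymbol\beta,\gamma)=\sum_{s\subset E}\ \prod_{n\ge0}\theta_{B_n}(1,\gamma)^{i_n(s)}\prod_{e\in s}\beta_e\prod_{e\in E\setminus s}(1-\beta_e),$$ where $i_n(s)$ is the number of connected components of the spanning subgraph $(V,s)$ with nullity $n$.
   Context: Loops contribute $2$ to degrees. $f_0=1,f_1=0,f_{n+1}(x)=xf_n(x)+f_{n-1}(x)$. $\Theta_G(\boldsymbol\beta,\boldsymbol\gamma)=\sum_{s\subset E}\prod_{e\in s}\beta_e\prod_{i\in V}f_{d_i(s)}(\gamma_i)$, $d_i(s)$ the degree of $i$ in $(V,s)$; $\Theta_G(\boldsymbol\beta,\gamma)$ denotes the case $\gamma_i=\gamma$ for all $i$, and $\theta_G(\beta,\gamma)$ the case where moreover all $\beta_e=\beta$. $B_n$ is the bouquet graph (one vertex, $n$ loops); thus $\theta_{B_n}(1,\gamma)=\sum_{k=0}^n\binom nk f_{2k}(\gamma)$. The nullity of a connected graph is $|E|-|V|+1$. *)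

theory Defs
  imports "HOL-Library.Multiset" "HOL-Library.Groups_Big_Fun"
begin

text \<open>
  An undirected multigraph, possibly with loops and multiple edges: \<open>ends G e\<close> is the two-element
  multiset of endpoints of \<open>e\<close>, and a loop at \<open>v\<close> has \<open>ends G e = {#v, v#}\<close>.
\<close>

record ('v, 'e) multigraph =
  verts :: "'v set"
  edges :: "'e set"
  ends :: "'e \<Rightarrow> 'v multiset"

locale finite_multigraph =
  fixes G :: "('v, 'e) multigraph"
  assumes finite_verts: "finite (verts G)"
    and finite_edges: "finite (edges G)"
    and size_ends: "e \<in> edges G \<Longrightarrow> size (ends G e) = 2"
    and ends_in_verts: "e \<in> edges G \<Longrightarrow> set_mset (ends G e) \<subseteq> verts G"

text \<open>A loop counts twice, since its endpoint has multiplicity 2 in \<open>ends G e\<close>.\<close>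

definition degree :: "('v, 'e) multigraph \<Rightarrow> 'v \<Rightarrow> nat" where
  "degree G v = (\<Sum>e\<in>edges G. count (ends G e) v)"

definition spanning_subgraph :: "('v, 'e) multigraph \<Rightarrow> 'e set \<Rightarrow> ('v, 'e) multigraph" where
  "spanning_subgraph G s = G\<lparr>edges := s\<rparr>"

definition induced_subgraph :: "('v, 'e) multigraph \<Rightarrow> 'v set \<Rightarrow> ('v, 'e) multigraph" where
  "induced_subgraph G W = G\<lparr>verts := W, edges := {e \<in> edges G. set_mset (ends G e) \<subseteq> W}\<rparr>"

definition adjacent :: "('v, 'e) multigraph \<Rightarrow> ('v \<times> 'v) set" where
  "adjacent G = {(u, v). \<exists>e\<in>edges G. ends G e = {#u, v#}}"

definition reachable :: "('v, 'e) multigraph \<Rightarrow> ('v \<times> 'v) set" where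
  "reachable G = {(u, v). u \<in> verts G \<and> v \<in> verts G \<and> (u, v) \<in> (adjacent G)\<^sup>*}"

definition connected_components :: "('v, 'e) multigraph \<Rightarrow> ('v, 'e) multigraph set" where
  "connected_components G = induced_subgraph G ` (verts G // reachable G)"

definition nullity :: "('v, 'e) multigraph \<Rightarrow> int" where
  "nullity G = int (card (edges G)) - int (card (verts G)) + 1"

definition num_components_nullity :: "('v, 'e) multigraph \<Rightarrow> nat \<Rightarrow> nat" where
  "num_components_nullity G n = card {C \<in> connected_components G. nullity C = int n}"

fun deg_poly :: "nat \<Rightarrow> 'a::comm_ring_1 \<Rightarrow> 'a" where
  "deg_poly 0 x = 1"
| "deg_poly (Suc 0) x = 0"
| "deg_poly (Suc (Suc n)) x = x * deg_poly (Suc n) x + deg_poly n x"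

definition Theta :: "('v, 'e) multigraph \<Rightarrow> ('e \<Rightarrow> 'a) \<Rightarrow> ('v \<Rightarrow> 'a) \<Rightarrow> 'a::comm_ring_1" where
  "Theta G \<beta> \<gamma> =
    (\<Sum>s\<in>Pow (edges G).
      (\<Prod>e\<in>s. \<beta> e) * (\<Prod>i\<in>verts G. deg_poly (degree (spanning_subgraph G s) i) (\<gamma> i)))"

definition theta :: "('v, 'e) multigraph \<Rightarrow> 'a \<Rightarrow> 'a \<Rightarrow> 'a::comm_ring_1" where
  "theta G b c = Theta G (\<lambda>_. b) (\<lambda>_. c)"

definition bouquet :: "nat \<Rightarrow> (unit, nat) multigraph" where
  "bouquet n = \<lparr>verts = {()}, edges = {..<n}, ends = (\<lambda>_. {#(), ()#})\<rparr>"

lemma theta_bouquet_1: "theta (bouquet n) 1 c = (\<Sum>k\<le>n. of_nat (n choose k) * deg_poly (2 * k) c)"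
proof -
  have "theta (bouquet n) 1 c = (\<Sum>s\<in>Pow {..<n}. deg_poly (2 * card s) c)"
    by (simp add: theta_def Theta_def bouquet_def spanning_subgraph_def degree_def mult_2 mult_2_right)
  also have "\<dots> = (\<Sum>k\<le>n. \<Sum>s\<in>{s \<in> Pow {..<n}. card s = k}. deg_poly (2 * card s) c)"
    by (rule sum.group [symmetric]) (auto dest: card_mono [rotated])
  also have "\<dots> = (\<Sum>k\<le>n. of_nat (n choose k) * deg_poly (2 * k) c)"
    by (rule sum.cong) (simp_all add: n_subsets [of "{..<n}", simplified])
  finally show ?thesis .
qed

end

theory Submission
  imports Defs "HOL-Library.Disjoint_Sets"
begin

text \<open>
  Splitting \<open>1 = \<beta>\<^sub>e + (1 - \<beta>\<^sub>e)\<close> for every edge outside the summation subset rewrites \<open>\<Theta>\<^sub>G(\<beta>, \<gamma>)\<close> as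
  the sum over \<open>s\<close> of \<open>\<Theta>\<close> of \<open>(V, s)\<close> at \<open>\<beta> = 1\<close>, weighted by the product of \<open>\<beta>\<^sub>e\<close> over \<open>s\<close> and
  of \<open>1 - \<beta>\<^sub>e\<close> off \<open>s\<close>. At \<open>\<beta> = 1\<close> the identity \<open>f\<^sub>a f\<^sub>b + f\<^sub>a\<^sub>+\<^sub>1 f\<^sub>b\<^sub>+\<^sub>1 = f\<^sub>a\<^sub>+\<^sub>b\<close> makes \<open>\<Theta>\<close> invariant under
  contraction of non-loop edges. Contraction preserves components and their nullities, so it
  ends at a disjoint union of bouquets, for which \<open>\<Theta>\<close> is a product. Contracted graphs are
  represented by partitions of the original vertex set, a block standing for a merged vertex.
\<close>

section \<open>Sums over power sets\<close>

lemma sum_Pow_Un_disjoint: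
  assumes "A \<inter> B = {}"
  shows "(\<Sum>t\<in>Pow (A \<union> B). F t) = (\<Sum>a\<in>Pow A. \<Sum>b\<in>Pow B. F (a \<union> b))"
proof -
  have "(\<Sum>a\<in>Pow A. \<Sum>b\<in>Pow B. F (a \<union> b)) = (\<Sum>(a, b)\<in>Pow A \<times> Pow B. F (a \<union> b))"
    by (rule sum.cartesian_product)
  also have "\<dots> = (\<Sum>t\<in>Pow (A \<union> B). F t)"
    by (rule sum.reindex_bij_witness[where i = "\<lambda>t. (t \<inter> A, t \<inter> B)" and j = "\<lambda>(a, b). a \<union> b"])
      (use assms in auto)
  finally show ?thesis ..
qed

lemma sum_Pow_insert:
  assumes "e \<notin> A"
  shows "(\<Sum>t\<in>Pow (insert e A). F t) = (\<Sum>t\<in>Pow A. F t + F (insert e t))"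
proof -
  have "{e} \<inter> A = {}" using assms by simp
  moreover have "Pow {e} = {{}, {e}}" by auto
  ultimately show ?thesis
    using sum_Pow_Un_disjoint[of "{e}" A F]
    by (simp add: sum.distrib add.commute)
qed

text \<open>A subset of a disjoint union is an independent choice of a subset of each
  \<open>A i\<close>, so distributivity applies. With \<open>A i\<close> the edges inside the i-th
  block, this makes the sum multiplicative over a disjoint union of graphs.\<close>

lemma sum_Pow_UN_prod:
  fixes g :: "'i \<Rightarrow> 'b set \<Rightarrow> 'a::comm_semiring_1"
  assumes "finite I" "disjoint_family_on A I"
  shows "(\<Sum>t\<in>Pow (\<Union>i\<in>I. A i). \<Prod>i\<in>I. g i (t \<inter> A i)) = (\<Prod>i\<in>I. \<Sum>t\<in>Pow (A i). g i t)"
  using assms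
proof (induction I rule: finite_induct)
  case empty
  then show ?case by simp
next
  case (insert j I)
  have disj: "A j \<inter> A i = {}" if "i \<in> I" for i
    using insert.prems insert.hyps that by (auto simp: disjoint_family_on_def)
  then have disj_UN: "A j \<inter> (\<Union>i\<in>I. A i) = {}" by blast
  have "disjoint_family_on A I"
    using insert.prems by (auto simp: disjoint_family_on_def)
  note IH = insert.IH[OF this]
  have "(\<Sum>t\<in>Pow (\<Union>i\<in>insert j I. A i). \<Prod>i\<in>insert j I. g i (t \<inter> A i))
      = (\<Sum>a\<in>Pow (A j). \<Sum>b\<in>Pow (\<Union>i\<in>I. A i). \<Prod>i\<in>insert j I. g i ((a \<union> b) \<inter> A i))"
    using sum_Pow_Un_disjoint[OF disj_UN] by simp
  also have "\<dots> = (\<Sum>a\<in>Pow (A j). \<Sum>b\<in>Pow (\<Union>i\<in>I. A i). g j a * (\<Prod>i\<in>I. g i (b \<inter> A i)))"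
  proof (intro sum.cong refl)
    fix a b assume a: "a \<in> Pow (A j)" and b: "b \<in> Pow (\<Union>i\<in>I. A i)"
    have "(a \<union> b) \<inter> A j = a" using a b disj_UN by blast
    moreover have "(a \<union> b) \<inter> A i = b \<inter> A i" if "i \<in> I" for i
      using a disj[OF that] by blast
    ultimately show "(\<Prod>i\<in>insert j I. g i ((a \<union> b) \<inter> A i)) = g j a * (\<Prod>i\<in>I. g i (b \<inter> A i))"
      using insert.hyps by (simp cong: prod.cong)
  qed
  also have "\<dots> = (\<Prod>i\<in>insert j I. \<Sum>t\<in>Pow (A i). g i t)"
    using insert.hyps IH by (simp add: sum_product[symmetric])
  finally show ?case .
qed

text \<open>For fixed t, the weights of all s with t \<subseteq> s \<subseteq> E add up to the
  product of \<beta> over t, because each edge outside t contributes \<beta> + (1 - \<beta>) = 1.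
  The induction leaves \<open>F\<close> arbitrary, as its step replaces \<open>F t\<close> by
  \<open>F t + \<beta> x * F (insert x t)\<close>.\<close>

lemma sum_Pow_prod_complement:
  fixes \<beta> :: "'e \<Rightarrow> 'a::comm_ring_1"
  assumes "finite E"
  shows "(\<Sum>t\<in>Pow E. (\<Prod>e\<in>t. \<beta> e) * F t)
    = (\<Sum>s\<in>Pow E. (\<Sum>t\<in>Pow s. F t) * (\<Prod>e\<in>s. \<beta> e) * (\<Prod>e\<in>E - s. 1 - \<beta> e))"
  using assms
proof (induction E arbitrary: F rule: finite_induct)
  case empty
  then show ?case by simp
next
  case (insert x E)
  let ?w = "\<lambda>s. (\<Prod>e\<in>s. \<beta> e) * (\<Prod>e\<in>E - s. 1 - \<beta> e)"
  let ?W = "\<lambda>s. (\<Sum>t\<in>Pow s. F t) * (\<Prod>e\<in>s. \<beta> e) * (\<Prod>e\<in>insert x E - s. 1 - \<beta> e)"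
  have "(\<Sum>t\<in>Pow (insert x E). (\<Prod>e\<in>t. \<beta> e) * F t)
      = (\<Sum>t\<in>Pow E. (\<Prod>e\<in>t. \<beta> e) * (F t + \<beta> x * F (insert x t)))"
    unfolding sum_Pow_insert[OF insert.hyps(2)]
  proof (rule sum.cong[OF refl])
    fix t assume "t \<in> Pow E"
    then have "finite t" "x \<notin> t" using insert.hyps by (auto dest: finite_subset)
    then show "(\<Prod>e\<in>t. \<beta> e) * F t + (\<Prod>e\<in>insert x t. \<beta> e) * F (insert x t)
        = (\<Prod>e\<in>t. \<beta> e) * (F t + \<beta> x * F (insert x t))"
      by (simp add: algebra_simps)
  qed
  also have "\<dots> = (\<Sum>s\<in>Pow E. (\<Sum>t\<in>Pow s. F t + \<beta> x * F (insert x t)) * ?w s)"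
    unfolding insert.IH by (simp add: mult.assoc)
  also have "\<dots> = (\<Sum>s\<in>Pow E. ?W s + ?W (insert x s))"
  proof (rule sum.cong[OF refl])
    fix s assume "s \<in> Pow E"
    then have fin: "finite s" and s: "x \<notin> s" using insert.hyps by (auto dest: finite_subset)
    have "insert x E - s = insert x (E - s)" using s by auto
    moreover have "x \<notin> E - s" "finite (E - s)" using insert.hyps by auto
    ultimately have off: "(\<Prod>e\<in>insert x E - s. 1 - \<beta> e) = (1 - \<beta> x) * (\<Prod>e\<in>E - s. 1 - \<beta> e)"
      by simp
    have on: "insert x E - insert x s = E - s" using insert.hyps by auto
    \<comment> \<open>\<open>F t\<close> occurs in both terms on the right, with total factor (1 -
      \<beta> x) + \<beta> x = 1, while \<open>F (insert x t)\<close> occurs only in the second,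
      with factor \<beta> x.\<close>
    show "(\<Sum>t\<in>Pow s. F t + \<beta> x * F (insert x t)) * ?w s = ?W s + ?W (insert x s)"
      unfolding off on using fin s
      by (simp add: sum_Pow_insert sum.distrib sum_distrib_left[symmetric]) (simp add: algebra_simps)
  qed
  also have "\<dots> = (\<Sum>s\<in>Pow (insert x E). ?W s)"
    by (rule sum_Pow_insert[OF insert.hyps(2), symmetric])
  finally show ?case .
qed

section \<open>The polynomials \<open>deg_poly\<close> and the degrees of merged vertices\<close>

text \<open>Both sides satisfy the recurrence of \<open>deg_poly\<close> in a; they agree at a = 0
  and a = 1 because the polynomials of index 0, 1, 2 are 1, 0, 1. On the right, the two terms will
  stand for omitting and for choosing an edge between vertices of degrees a and b.\<close>

lemma deg_poly_add:
  "deg_poly (a + b) x = deg_poly a x * deg_poly b x + deg_poly (Suc a) x * deg_poly (Suc b) x"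
proof (induction a x rule: deg_poly.induct)
  case (3 n x)
  then show ?case by (simp add: algebra_simps)
qed simp_all

lemma size_filter_mset_Un_disjoint:
  assumes "A \<inter> B = {}"
  shows "size (filter_mset (\<lambda>v. v \<in> A \<union> B) M)
    = size (filter_mset (\<lambda>v. v \<in> A) M) + size (filter_mset (\<lambda>v. v \<in> B) M)"
  using assms by (induction M) auto

text \<open>The degree of the vertex to which B collapses. Endpoints are counted with multiplicity,
  so an edge with both ends in B contributes 2, like the loop that it becomes.\<close>

definition block_degree :: "('e \<Rightarrow> 'v multiset) \<Rightarrow> 'e set \<Rightarrow> 'v set \<Rightarrow> nat" where
  "block_degree \<epsilon> t B = (\<Sum>e\<in>t. size (filter_mset (\<lambda>v. v \<in> B) (\<epsilon> e)))"

definition edges_within :: "('e \<Rightarrow> 'v multiset) \<Rightarrow> 'e set \<Rightarrow> 'v set \<Rightarrow> 'e set" where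
  "edges_within \<epsilon> E W = {e \<in> E. set_mset (\<epsilon> e) \<subseteq> W}"

text \<open>Connectivity without paths: a set of vertices is a union of connected components exactly
  when it is saturated for the endpoint sets of the edges.\<close>

definition saturated :: "'v set set \<Rightarrow> 'v set \<Rightarrow> bool" where
  "saturated \<A> U \<longleftrightarrow> (\<forall>A\<in>\<A>. A \<subseteq> U \<or> A \<inter> U = {})"

lemma saturated_insert:
  "saturated (insert A \<A>) U \<longleftrightarrow> (A \<subseteq> U \<or> A \<inter> U = {}) \<and> saturated \<A> U"
  by (simp add: saturated_def)

lemma saturated_Un: "saturated (\<A> \<union> \<B>) U \<longleftrightarrow> saturated \<A> U \<and> saturated \<B> U"
  by (auto simp: saturated_def)

lemma block_degree_Un_disjoint:
  "A \<inter> B = {} \<Longrightarrow> block_degree \<epsilon> t (A \<union> B) = block_degree \<epsilon> t A + block_degree \<epsilon> t B"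
  unfolding block_degree_def
  by (simp only: size_filter_mset_Un_disjoint sum.distrib)

section \<open>Evaluation at edge weights 1 by contraction\<close>

text \<open>The end of the contraction process: every edge has become a loop at some block, so a
  block has degree twice the number of chosen edges inside it and the sum factors over the
  blocks.\<close>

lemma sum_deg_poly_bouquets:
  fixes \<gamma> :: "'a::comm_ring_1"
  assumes "finite V" "finite E" and P: "partition_on V P"
    and size: "\<And>e. e \<in> E \<Longrightarrow> size (\<epsilon> e) = 2"
    and within: "\<And>e. e \<in> E \<Longrightarrow> \<exists>B\<in>P. set_mset (\<epsilon> e) \<subseteq> B"
  shows "(\<Sum>t\<in>Pow E. \<Prod>B\<in>P. deg_poly (block_degree \<epsilon> t B) \<gamma>)
    = (\<Prod>B\<in>P. theta (bouquet (card (edges_within \<epsilon> E B))) 1 \<gamma>)"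
proof -
  let ?E = "edges_within \<epsilon> E"
  have finP: "finite P" using finite_elements[OF \<open>finite V\<close> P] .
  \<comment> \<open>An edge without endpoints would lie within every block, and the sets
    \<open>?E B\<close> would not be disjoint.\<close>
  have nonempty: "set_mset (\<epsilon> e) \<noteq> {}" if "e \<in> E" for e
    using size[OF that] by auto
  have disjP: "B = B'" if "B \<in> P" "B' \<in> P" "x \<in> B" "x \<in> B'" for B B' x
    using P that by (auto simp: partition_on_def disjoint_def)
  have "disjoint_family_on ?E P"
    unfolding disjoint_family_on_def edges_within_def
  proof (intro ballI impI equals0I)
    fix B B' e assume *: "B \<in> P" "B' \<in> P" "B \<noteq> B'"
      "e \<in> {e \<in> E. set_mset (\<epsilon> e) \<subseteq> B} \<inter> {e \<in> E. set_mset (\<epsilon> e) \<subseteq> B'}"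
    then obtain x where "x \<in># \<epsilon> e" using nonempty[of e] by blast
    then show False using * disjP[of B B' x] by auto
  qed
  moreover have "(\<Union>B\<in>P. ?E B) = E"
    using within by (auto simp: edges_within_def)
  moreover have "block_degree \<epsilon> t B = 2 * card (t \<inter> ?E B)" if t: "t \<subseteq> E" and B: "B \<in> P" for t B
  proof -
    have "size (filter_mset (\<lambda>v. v \<in> B) (\<epsilon> e)) = (if e \<in> ?E B then 2 else 0)" if "e \<in> t" for e
    proof -
      have e: "e \<in> E" using that t by auto
      then obtain B' where B': "B' \<in> P" "set_mset (\<epsilon> e) \<subseteq> B'" using within by blast
      show ?thesis
      proof (cases "e \<in> ?E B")
        case True
        then have "filter_mset (\<lambda>v. v \<in> B) (\<epsilon> e) = \<epsilon> e"
          by (auto simp: edges_within_def filter_mset_eq_conv)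
        then show ?thesis using True size[OF e] by simp
      next
        case False
        then have "B \<noteq> B'" using B' e by (auto simp: edges_within_def)
        then have "\<forall>v \<in># \<epsilon> e. v \<notin> B" using B' disjP B by blast
        then show ?thesis using False by (simp add: filter_mset_eq_mempty_iff)
      qed
    qed
    then have "block_degree \<epsilon> t B = (\<Sum>e\<in>t. if e \<in> ?E B then 2 else 0)"
      by (simp add: block_degree_def)
    also have "\<dots> = 2 * card (t \<inter> ?E B)"
      using finite_subset[OF t \<open>finite E\<close>] by (simp add: sum.If_cases)
    finally show ?thesis .
  qed
  then have "(\<Sum>t\<in>Pow E. \<Prod>B\<in>P. deg_poly (block_degree \<epsilon> t B) \<gamma>)
      = (\<Sum>t\<in>Pow E. \<Prod>B\<in>P. deg_poly (2 * card (t \<inter> ?E B)) \<gamma>)"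
    by (intro sum.cong prod.cong) auto
  moreover have "(\<Sum>t\<in>Pow (?E B). deg_poly (2 * card t) \<gamma>) = theta (bouquet (card (?E B))) 1 \<gamma>" for B
  proof -
    have fin: "finite (?E B)" using \<open>finite E\<close> by (simp add: edges_within_def)
    have "(\<Sum>t\<in>Pow (?E B). deg_poly (2 * card t) \<gamma>)
        = (\<Sum>k\<le>card (?E B). \<Sum>t\<in>{t \<in> Pow (?E B). card t = k}. deg_poly (2 * card t) \<gamma>)"
      by (rule sum.group[symmetric]) (use fin in \<open>auto dest: card_mono[rotated]\<close>)
    also have "\<dots> = theta (bouquet (card (?E B))) 1 \<gamma>"
      unfolding theta_bouquet_1 by (rule sum.cong) (simp_all add: n_subsets[OF fin, simplified])
    finally show ?thesis .
  qed
  ultimately show ?thesis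
    using sum_Pow_UN_prod[OF finP, of ?E "\<lambda>B t. deg_poly (2 * card t) \<gamma>"] by simp
qed

text \<open>Pair each t with \<open>insert e t\<close>. If B and B' have degrees a and b in t, the
  pair contributes the two terms of \<open>deg_poly_add\<close>, whose sum belongs to degree a + b,
  that of the merged block. No other block meets e.\<close>

lemma sum_deg_poly_contract:
  fixes \<gamma> :: "'a::comm_ring_1" and P :: "'v set set"
  assumes "finite P" "finite E" "e \<notin> E" and B: "B \<in> P" "B' \<in> P" "B \<noteq> B'"
    and disj: "disjoint P" and new: "B \<union> B' \<notin> P - {B, B'}"
    and e: "\<epsilon> e = {#u, v#}" "u \<in> B" "v \<in> B'"
  shows "(\<Sum>t\<in>Pow (insert e E). \<Prod>C\<in>P. deg_poly (block_degree \<epsilon> t C) \<gamma>)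
    = (\<Sum>t\<in>Pow E. \<Prod>C\<in>insert (B \<union> B') (P - {B, B'}). deg_poly (block_degree \<epsilon> t C) \<gamma>)"
  unfolding sum_Pow_insert[OF \<open>e \<notin> E\<close>]
proof (rule sum.cong[OF refl])
  fix t assume "t \<in> Pow E"
  then have t: "finite t" "e \<notin> t" using assms by (auto dest: finite_subset)
  have disjB: "C \<inter> D = {}" if "C \<in> P" "D \<in> P" "C \<noteq> D" for C D
    using disj that by (auto simp: disjoint_def)
  have ins: "block_degree \<epsilon> (insert e t) C
      = size (filter_mset (\<lambda>v. v \<in> C) (\<epsilon> e)) + block_degree \<epsilon> t C" for C
    using t by (simp add: block_degree_def)
  have uv: "u \<notin> B'" "v \<notin> B" using disjB[OF B] e by auto
  have degB: "block_degree \<epsilon> (insert e t) B = Suc (block_degree \<epsilon> t B)"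
    "block_degree \<epsilon> (insert e t) B' = Suc (block_degree \<epsilon> t B')"
    unfolding ins using e uv by simp_all
  have degC: "block_degree \<epsilon> (insert e t) C = block_degree \<epsilon> t C" if "C \<in> P - {B, B'}" for C
  proof -
    have "u \<notin> C" "v \<notin> C" using disjB[of C B] disjB[of C B'] that B e by auto
    then show ?thesis unfolding ins using e by simp
  qed
  have prodC: "(\<Prod>C\<in>P - {B, B'}. deg_poly (block_degree \<epsilon> (insert e t) C) \<gamma>)
      = (\<Prod>C\<in>P - {B, B'}. deg_poly (block_degree \<epsilon> t C) \<gamma>)"
    by (rule prod.cong) (simp_all only: degC)
  have split: "(\<Prod>C\<in>P. F C) = F B * F B' * (\<Prod>C\<in>P - {B, B'}. F C)" for F :: "'v set \<Rightarrow> 'a"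
  proof -
    have "P = insert B (insert B' (P - {B, B'}))" using B by auto
    then have "prod F P = prod F (insert B (insert B' (P - {B, B'})))" by (rule arg_cong)
    then show ?thesis using B(3) \<open>finite P\<close> by (simp add: mult.assoc)
  qed
  show "(\<Prod>C\<in>P. deg_poly (block_degree \<epsilon> t C) \<gamma>)
      + (\<Prod>C\<in>P. deg_poly (block_degree \<epsilon> (insert e t) C) \<gamma>)
    = (\<Prod>C\<in>insert (B \<union> B') (P - {B, B'}). deg_poly (block_degree \<epsilon> t C) \<gamma>)"
    unfolding split prodC using new \<open>finite P\<close> disjB[OF B]
    by (simp add: degB block_degree_Un_disjoint deg_poly_add algebra_simps)
qed

text \<open>
  The last two hypotheses on \<open>Q\<close> say that \<open>Q\<close> consists of the components of the graph obtained from
  \<open>E\<close> by collapsing the blocks of \<open>P\<close>. They only mention the sets saturated for the blocks and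
  the edges together, and these sets do not change when an edge is contracted.
\<close>

lemma sum_deg_poly_components:
  fixes \<gamma> :: "'a::comm_ring_1"
  assumes "finite V" "finite E" "partition_on V P" and Q: "partition_on V Q"
    and "\<And>e. e \<in> E \<Longrightarrow> size (\<epsilon> e) = 2" "\<And>e. e \<in> E \<Longrightarrow> set_mset (\<epsilon> e) \<subseteq> V"
    and "\<And>W. W \<in> Q \<Longrightarrow> saturated (P \<union> (\<lambda>e. set_mset (\<epsilon> e)) ` E) W"
    and "\<And>U. saturated (P \<union> (\<lambda>e. set_mset (\<epsilon> e)) ` E) U \<Longrightarrow> saturated Q U"
  shows "(\<forall>W\<in>Q. card {B \<in> P. B \<subseteq> W} \<le> card (edges_within \<epsilon> E W) + 1) \<and>
    (\<Sum>t\<in>Pow E. \<Prod>B\<in>P. deg_poly (block_degree \<epsilon> t B) \<gamma>)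
    = (\<Prod>W\<in>Q. theta (bouquet (card (edges_within \<epsilon> E W) + 1 - card {B \<in> P. B \<subseteq> W})) 1 \<gamma>)"
  using assms(2,3,5-)
\<comment> \<open>Contracting an edge changes P together with E, while V and Q stay fixed.\<close>
proof (induction E arbitrary: P rule: finite_psubset_induct)
  case (psubset E)
  note P = \<open>partition_on V P\<close> and size = psubset.prems(2) and ends = psubset.prems(3)
    and Q_saturated = psubset.prems(4) and saturated_Q = psubset.prems(5)
  have finP: "finite P" using finite_elements[OF \<open>finite V\<close> P] .
  have disjP: "C = D" if "C \<in> P" "D \<in> P" "x \<in> C" "x \<in> D" for C D x
    using P that by (auto simp: partition_on_def disjoint_def)
  have disjQ: "C = D" if "C \<in> Q" "D \<in> Q" "x \<in> C" "x \<in> D" for C D x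
    using Q that by (auto simp: partition_on_def disjoint_def)
  have neP: "C \<noteq> {}" if "C \<in> P" for C using P that by (auto simp: partition_on_def)
  have neQ: "C \<noteq> {}" if "C \<in> Q" for C using Q that by (auto simp: partition_on_def)
  have unP: "\<Union>P = V" and unQ: "\<Union>Q = V" using P Q by (auto simp: partition_on_def)
  have two: "\<exists>u v. \<epsilon> e = {#u, v#}" if "e \<in> E" for e
  proof -
    have "size (\<epsilon> e) = Suc 1" using size[OF that] by simp
    then obtain u N where N: "\<epsilon> e = add_mset u N" "size N = 1"
      by (metis size_eq_Suc_imp_eq_union size_add_mset nat.inject)
    then show ?thesis using N by (metis size_1_singleton_mset)
  qed
  show ?case
  proof (cases "\<forall>e\<in>E. \<exists>B\<in>P. set_mset (\<epsilon> e) \<subseteq> B")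
    case True
    \<comment> \<open>No edge leaves its block, so the blocks are saturated and hence Q refines P.
      Members of Q are saturated for P, so P refines Q as well, and the two partitions
      coincide.\<close>
    have "saturated (P \<union> (\<lambda>e. set_mset (\<epsilon> e)) ` E) B" if B: "B \<in> P" for B
      unfolding saturated_def
    proof (intro ballI)
      fix A assume "A \<in> P \<union> (\<lambda>e. set_mset (\<epsilon> e)) ` E"
      then obtain C where "C \<in> P" "A \<subseteq> C" using True by blast
      then show "A \<subseteq> B \<or> A \<inter> B = {}" using disjP[OF B] by blast
    qed
    from saturated_Q[OF this] have QP: "W \<subseteq> B" if "W \<in> Q" "B \<in> P" "x \<in> W" "x \<in> B" for W B x
      using that by (auto simp: saturated_def)
    have PQ: "B \<subseteq> W" if "W \<in> Q" "B \<in> P" "x \<in> W" "x \<in> B" for W B x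
      using Q_saturated[OF that(1)] that by (auto simp: saturated_def)
    have "P = Q"
    proof (intro equalityI subsetI)
      fix B assume B: "B \<in> P"
      then obtain x where x: "x \<in> B" using neP by blast
      then obtain W where "W \<in> Q" "x \<in> W" using B unP unQ by blast
      then show "B \<in> Q" using QP PQ B x by (metis subset_antisym)
    next
      fix W assume W: "W \<in> Q"
      then obtain x where x: "x \<in> W" using neQ by blast
      then obtain B where "B \<in> P" "x \<in> B" using W unP unQ by blast
      then show "W \<in> P" using QP PQ W x by (metis subset_antisym)
    qed
    have "B = W" if "W \<in> Q" "B \<in> Q" "B \<subseteq> W" for B W
      using disjQ[OF that(1,2)] neQ[OF that(2)] that(3) by blast
    then have "{B \<in> P. B \<subseteq> W} = {W}" if "W \<in> Q" for W
      using that unfolding \<open>P = Q\<close> by blast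
    \<comment> \<open>With a single block in W, the index of the bouquet is the number of loops
      there.\<close>
    then have card1: "card {B \<in> P. B \<subseteq> W} = 1" if "W \<in> Q" for W
      using that by simp
    have "(\<Sum>t\<in>Pow E. \<Prod>B\<in>P. deg_poly (block_degree \<epsilon> t B) \<gamma>)
        = (\<Prod>B\<in>P. theta (bouquet (card (edges_within \<epsilon> E B))) 1 \<gamma>)"
      by (rule sum_deg_poly_bouquets[OF \<open>finite V\<close> \<open>finite E\<close> P]) (use size True in auto)
    also have "\<dots> = (\<Prod>W\<in>Q. theta (bouquet (card (edges_within \<epsilon> E W) + 1
        - card {B \<in> P. B \<subseteq> W})) 1 \<gamma>)"
      by (rule prod.cong[OF \<open>P = Q\<close>]) (simp add: card1)
    finally show ?thesis using card1 by simp
  next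
    case False
    then obtain e where e: "e \<in> E" "\<And>B. B \<in> P \<Longrightarrow> \<not> set_mset (\<epsilon> e) \<subseteq> B" by blast
    obtain u v where uv: "\<epsilon> e = {#u, v#}" using two[OF e(1)] by blast
    then obtain B B' where B: "B \<in> P" "u \<in> B" and B': "B' \<in> P" "v \<in> B'"
      using ends[OF e(1)] unP by auto
    then have neq: "B \<noteq> B'" using e(2) uv by auto
    define E' where "E' = E - {e}"
    define P' where "P' = insert (B \<union> B') (P - {B, B'})"
    have E: "E = insert e E'" "e \<notin> E'" "finite E'"
      using e(1) \<open>finite E\<close> by (auto simp: E'_def)
    have new: "B \<union> B' \<notin> P" using disjP B B' neq by (metis Un_iff)
    have P': "partition_on V P'"
      unfolding partition_on_def
    proof (intro conjI)
      show "\<Union>P' = V" using unP B B' by (auto simp: P'_def)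
      have "(B \<union> B') \<inter> C = {}" if "C \<in> P - {B, B'}" for C
        using disjP[OF B(1), of C] disjP[OF B'(1), of C] that by auto
      moreover have "disjoint (P - {B, B'})"
        using P by (auto simp: partition_on_def intro: pairwise_subset)
      ultimately show "disjoint P'"
        by (auto simp: P'_def pairwise_insert disjnt_def)
      show "{} \<notin> P'" using neP B by (auto simp: P'_def)
    qed
    have resp: "saturated (P' \<union> (\<lambda>e. set_mset (\<epsilon> e)) ` E') U
        \<longleftrightarrow> saturated (P \<union> (\<lambda>e. set_mset (\<epsilon> e)) ` E) U" for U
    proof -
      \<comment> \<open>The pair {u, v} meets both B and B', so the three conditions together force
        B and B' to lie on the same side of U.\<close>
      have merge: "(B \<union> B' \<subseteq> U \<or> (B \<union> B') \<inter> U = {}) \<longleftrightarrow>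
        (B \<subseteq> U \<or> B \<inter> U = {}) \<and> (B' \<subseteq> U \<or> B' \<inter> U = {}) \<and> ({u, v} \<subseteq> U \<or> {u, v} \<inter> U = {})"
        using B(2) B'(2) by blast
      have "P = insert B (insert B' (P - {B, B'}))" using B B' by auto
      then have "saturated P U \<longleftrightarrow> saturated (insert B (insert B' (P - {B, B'}))) U"
        by (rule arg_cong)
      then show ?thesis
        unfolding saturated_Un P'_def E(1) image_insert uv saturated_insert merge
          set_mset_add_mset_insert set_mset_empty
        by argo
    qed
    \<comment> \<open>k is 1 if e lies within W and 0 otherwise: blocks and edges decrease by the
      same amount, so the nullity is preserved. The additive form yields both the inequality and the
      equality of the natural differences.\<close>
    have cards: "\<exists>k. card {C \<in> P. C \<subseteq> W} = card {C \<in> P'. C \<subseteq> W} + k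
        \<and> card (edges_within \<epsilon> E W) = card (edges_within \<epsilon> E' W) + k" if W: "W \<in> Q" for W
    proof -
      have "{u, v} \<in> (\<lambda>e. set_mset (\<epsilon> e)) ` E" using e(1) uv by (force intro: image_eqI[of _ _ e])
      then have r: "C \<subseteq> W \<or> C \<inter> W = {}" if "C \<in> P \<or> C = {u, v}" for C
        using Q_saturated[OF W] that unfolding saturated_def by blast
      show ?thesis
      proof (cases "u \<in> W")
        case True
        then have sub: "B \<subseteq> W" "v \<in> W" using r[of B] r[of "{u, v}"] B by auto
        then have "B' \<subseteq> W" using r[of B'] B' by auto
        let ?R = "{C \<in> P - {B, B'}. C \<subseteq> W}"
        have "{C \<in> P. C \<subseteq> W} = insert B (insert B' ?R)"
          "{C \<in> P'. C \<subseteq> W} = insert (B \<union> B') ?R"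
          using \<open>B' \<subseteq> W\<close> sub B B' by (auto simp: P'_def)
        then have "card {C \<in> P. C \<subseteq> W} = card {C \<in> P'. C \<subseteq> W} + 1"
          using finP neq new by simp
        moreover have "edges_within \<epsilon> E W = insert e (edges_within \<epsilon> E' W)"
          using True sub uv by (auto simp: edges_within_def E(1))
        then have "card (edges_within \<epsilon> E W) = card (edges_within \<epsilon> E' W) + 1"
          using E by (simp add: edges_within_def)
        ultimately show ?thesis by blast
      next
        case False
        then have "\<not> B \<subseteq> W" "v \<notin> W" using r[of "{u, v}"] B by auto
        then have "\<not> B' \<subseteq> W" using B' by auto
        have "{C \<in> P. C \<subseteq> W} = {C \<in> P'. C \<subseteq> W}"
          using \<open>\<not> B \<subseteq> W\<close> \<open>\<not> B' \<subseteq> W\<close> by (auto simp: P'_def)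
        moreover have "edges_within \<epsilon> E W = edges_within \<epsilon> E' W"
          using False uv by (auto simp: edges_within_def E(1))
        ultimately show ?thesis by simp
      qed
    qed
    have "E' \<subset> E" using E by auto
    have IH: "(\<forall>W\<in>Q. card {B \<in> P'. B \<subseteq> W} \<le> card (edges_within \<epsilon> E' W) + 1) \<and>
      (\<Sum>t\<in>Pow E'. \<Prod>B\<in>P'. deg_poly (block_degree \<epsilon> t B) \<gamma>)
      = (\<Prod>W\<in>Q. theta (bouquet (card (edges_within \<epsilon> E' W) + 1 - card {B \<in> P'. B \<subseteq> W})) 1 \<gamma>)"
    proof (rule psubset.IH[OF \<open>E' \<subset> E\<close> P'])
      show "size (\<epsilon> x) = 2" "set_mset (\<epsilon> x) \<subseteq> V" if "x \<in> E'" for x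
        using size ends that E by auto
    qed (simp_all only: resp Q_saturated saturated_Q)
    have "disjoint P" using P by (simp add: partition_on_def)
    have "(\<Sum>t\<in>Pow E. \<Prod>B\<in>P. deg_poly (block_degree \<epsilon> t B) \<gamma>)
        = (\<Sum>t\<in>Pow E'. \<Prod>B\<in>P'. deg_poly (block_degree \<epsilon> t B) \<gamma>)"
      unfolding E(1) P'_def
      by (rule sum_deg_poly_contract)
        (use finP E B B' neq new uv \<open>disjoint P\<close> in auto)
    also have "\<dots> = (\<Prod>W\<in>Q. theta (bouquet (card (edges_within \<epsilon> E' W) + 1
        - card {B \<in> P'. B \<subseteq> W})) 1 \<gamma>)"
      by (rule conjunct2[OF IH])
    also have "\<dots> = (\<Prod>W\<in>Q. theta (bouquet (card (edges_within \<epsilon> E W) + 1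
        - card {B \<in> P. B \<subseteq> W})) 1 \<gamma>)"
    proof (rule prod.cong[OF refl])
      fix W assume "W \<in> Q"
      then have "card (edges_within \<epsilon> E W) + 1 - card {B \<in> P. B \<subseteq> W}
        = card (edges_within \<epsilon> E' W) + 1 - card {B \<in> P'. B \<subseteq> W}"
        using cards by fastforce
      then show "theta (bouquet (card (edges_within \<epsilon> E' W) + 1 - card {B \<in> P'. B \<subseteq> W})) 1 \<gamma>
        = theta (bouquet (card (edges_within \<epsilon> E W) + 1 - card {B \<in> P. B \<subseteq> W})) 1 \<gamma>"
        by (simp only:)
    qed
    finally show ?thesis using cards conjunct1[OF IH] by fastforce
  qed
qed

section \<open>Connected components of a multigraph and their nullities\<close>

context finite_multigraph
begin

lemma finite_multigraph_spanning_subgraph: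
  "s \<subseteq> edges G \<Longrightarrow> finite_multigraph (spanning_subgraph G s)"
  using finite_verts finite_edges size_ends ends_in_verts
  by unfold_locales (auto simp: spanning_subgraph_def dest: finite_subset)

lemma equiv_reachable: "equiv (verts G) (reachable G)"
proof (rule equivI)
  show "reachable G \<subseteq> verts G \<times> verts G" by (auto simp: reachable_def)
  show "refl_on (verts G) (reachable G)" by (auto simp: refl_on_def reachable_def)
  have "sym (adjacent G)" by (auto simp: sym_def adjacent_def add_mset_commute)
  then have "sym ((adjacent G)\<^sup>*)" by (rule sym_rtrancl)
  then show "sym (reachable G)" by (auto simp: sym_def reachable_def)
  show "trans (reachable G)" by (auto simp: trans_def reachable_def)
qed

lemma partition_on_components: "partition_on (verts G) (verts G // reachable G)"
  by (rule partition_on_quotient[OF equiv_reachable])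

text \<open>An edge leaving W would have one endpoint in W adjacent to another outside W, although W
  is closed under reachability.\<close>

lemma component_saturated_edges:
  assumes W: "W \<in> verts G // reachable G"
  shows "saturated ((\<lambda>e. set_mset (ends G e)) ` edges G) W"
proof (rule ccontr)
  assume "\<not> ?thesis"
  then obtain e x y where e: "e \<in> edges G" "x \<in># ends G e" "y \<in># ends G e" "x \<in> W" "y \<notin> W"
    unfolding saturated_def by blast
  then have "x \<noteq> y" by auto
  obtain M where M: "ends G e = add_mset x M" using e(2) by (rule mset_add)
  then have "y \<in># M" using e(3) \<open>x \<noteq> y\<close> by simp
  then obtain N where "M = add_mset y N" by (rule mset_add)
  \<comment> \<open>The two distinct endpoints already exhaust a multiset of size 2.\<close>
  with M have N: "ends G e = {#x, y#} + N" by simp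
  then have "N = {#}" using size_ends[OF e(1)] by simp
  then have "(x, y) \<in> adjacent G" using N e by (auto simp: adjacent_def)
  then have "(x, y) \<in> reachable G"
    using ends_in_verts[OF e(1)] e by (auto simp: reachable_def)
  then show False using in_quotient_imp_closed[OF equiv_reachable W e(4)] e(5) by blast
qed

text \<open>Membership in U is constant along each edge, hence along each path, hence on each
  class.\<close>

lemma saturated_components:
  assumes U: "saturated ((\<lambda>e. set_mset (ends G e)) ` edges G) U"
  shows "saturated (verts G // reachable G) U"
proof -
  have step: "x \<in> U \<longleftrightarrow> y \<in> U" if "(x, y) \<in> adjacent G" for x y
    using U that by (force simp: adjacent_def saturated_def)
  have path: "x \<in> U \<longleftrightarrow> y \<in> U" if "(x, y) \<in> (adjacent G)\<^sup>*" for x y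
    using that by (induction rule: rtrancl_induct) (use step in auto)
  show ?thesis
    by (auto simp: saturated_def quotient_def reachable_def) (use path in blast)+
qed

text \<open>Contraction starts from singleton blocks: block degrees are ordinary degrees, and W
  contains \<open>card W\<close> blocks. The first claim says that components have nonnegative
  nullity, so the subtraction in the second does not truncate.\<close>

lemma sum_deg_poly_eq_prod_components:
  fixes \<gamma> :: "'a::comm_ring_1"
  shows "W \<in> verts G // reachable G \<Longrightarrow> card W \<le> card (edges_within (ends G) (edges G) W) + 1"
    and "(\<Sum>t\<in>Pow (edges G). \<Prod>v\<in>verts G. deg_poly (degree (spanning_subgraph G t) v) \<gamma>)
      = (\<Prod>W\<in>verts G // reachable G.
          theta (bouquet (card (edges_within (ends G) (edges G) W) + 1 - card W)) 1 \<gamma>)"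
proof -
  let ?P = "(\<lambda>v. {v}) ` verts G" and ?Q = "verts G // reachable G"
  have P: "partition_on (verts G) ?P"
    by (auto simp: partition_on_def disjoint_def)
  \<comment> \<open>A singleton lies inside or outside any set, so the initial partition adds no
    condition.\<close>
  have resp: "saturated (?P \<union> (\<lambda>e. set_mset (ends G e)) ` edges G) U
      \<longleftrightarrow> saturated ((\<lambda>e. set_mset (ends G e)) ` edges G) U" for U
    by (auto simp: saturated_def)
  have *: "(\<forall>W\<in>?Q. card {B \<in> ?P. B \<subseteq> W} \<le> card (edges_within (ends G) (edges G) W) + 1) \<and>
    (\<Sum>t\<in>Pow (edges G). \<Prod>B\<in>?P. deg_poly (block_degree (ends G) t B) \<gamma>)
    = (\<Prod>W\<in>?Q. theta (bouquet (card (edges_within (ends G) (edges G) W) + 1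
        - card {B \<in> ?P. B \<subseteq> W})) 1 \<gamma>)"
    by (rule sum_deg_poly_components[OF finite_verts finite_edges P partition_on_components])
      (use size_ends ends_in_verts component_saturated_edges saturated_components resp in auto)
  have card: "card {B \<in> ?P. B \<subseteq> W} = card W" if "W \<in> ?Q" for W
  proof -
    have "W \<subseteq> verts G" using that partition_on_components by (auto simp: partition_on_def)
    then have "{B \<in> ?P. B \<subseteq> W} = (\<lambda>v. {v}) ` W" by auto
    then show ?thesis by (simp add: card_image)
  qed
  show "card W \<le> card (edges_within (ends G) (edges G) W) + 1" if "W \<in> ?Q"
    using * card[OF that] that by auto
  have "block_degree (ends G) t {v} = degree (spanning_subgraph G t) v" for t v
    by (simp add: block_degree_def degree_def spanning_subgraph_def filter_eq_replicate_mset)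
  then have "(\<Prod>B\<in>?P. deg_poly (block_degree (ends G) t B) \<gamma>)
      = (\<Prod>v\<in>verts G. deg_poly (degree (spanning_subgraph G t) v) \<gamma>)" for t
    by (simp add: prod.reindex)
  then show "(\<Sum>t\<in>Pow (edges G). \<Prod>v\<in>verts G. deg_poly (degree (spanning_subgraph G t) v) \<gamma>)
      = (\<Prod>W\<in>?Q. theta (bouquet (card (edges_within (ends G) (edges G) W) + 1 - card W)) 1 \<gamma>)"
    using * card by (simp cong: prod.cong)
qed

lemma nullity_induced_subgraph:
  "nullity (induced_subgraph G W)
    = int (card (edges_within (ends G) (edges G) W)) - int (card W) + 1"
  by (simp add: nullity_def induced_subgraph_def edges_within_def)

text \<open>Group the classes by nullity: each n collects one factor \<open>h n\<close> per
  component of nullity n.\<close>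

lemma Prod_any_num_components_nullity:
  fixes h :: "nat \<Rightarrow> 'a::comm_ring_1"
  shows "(\<Prod>n. h n ^ num_components_nullity G n)
    = (\<Prod>W\<in>verts G // reachable G. h (card (edges_within (ends G) (edges G) W) + 1 - card W))"
proof -
  let ?Q = "verts G // reachable G"
  let ?n = "\<lambda>W. card (edges_within (ends G) (edges G) W) + 1 - card W"
  have finQ: "finite ?Q" using finite_elements[OF finite_verts partition_on_components] .
  have null: "nullity (induced_subgraph G W) = int (?n W)" if "W \<in> ?Q" for W
    using sum_deg_poly_eq_prod_components(1)[OF that]
    by (simp add: nullity_induced_subgraph of_nat_diff)
  have num: "num_components_nullity G n = card {W \<in> ?Q. ?n W = n}" for n
  proof -
    have "{C \<in> connected_components G. nullity C = int n}
        = induced_subgraph G ` {W \<in> ?Q. ?n W = n}"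
      using null by (auto simp: connected_components_def)
    \<comment> \<open>An induced subgraph records its vertex set, so counting component graphs is
      counting classes.\<close>
    moreover have "inj (induced_subgraph G)"
      by (rule injI) (auto simp: induced_subgraph_def dest: arg_cong[where f = verts])
    ultimately show ?thesis
      by (simp add: num_components_nullity_def card_image inj_on_subset)
  qed
  \<comment> \<open>\<open>Prod_any\<close> is 1 by default when infinitely many factors differ from
    1, so the support has to be bounded: a nullity that does not occur has exponent 0.\<close>
  have "{n. h n ^ num_components_nullity G n \<noteq> 1} \<subseteq> ?n ` ?Q"
  proof (intro subsetI, rule ccontr)
    fix n assume n: "n \<in> {n. h n ^ num_components_nullity G n \<noteq> 1}" "n \<notin> ?n ` ?Q"
    then have "{W \<in> ?Q. ?n W = n} = {}" by auto
    then have "num_components_nullity G n = 0" unfolding num by (simp only: card.empty)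
    then show False using n(1) by simp
  qed
  then have "(\<Prod>n. h n ^ num_components_nullity G n)
      = (\<Prod>n\<in>?n ` ?Q. h n ^ num_components_nullity G n)"
    using finQ by (intro Prod_any.expand_superset) auto
  also have "\<dots> = (\<Prod>n\<in>?n ` ?Q. \<Prod>W\<in>{W \<in> ?Q. ?n W = n}. h (?n W))"
    by (simp add: num)
  also have "\<dots> = (\<Prod>W\<in>?Q. h (?n W))"
    by (rule prod.group) (use finQ in auto)
  finally show ?thesis .
qed

end

section \<open>The expansion over spanning subgraphs\<close>

theorem theorem7p3:
  fixes G :: "('v, 'e) multigraph"
    and \<beta> :: "'e \<Rightarrow> 'a::comm_ring_1"
    and \<gamma> :: 'a
  assumes "finite_multigraph G"
  shows "Theta G \<beta> (\<lambda>_. \<gamma>) =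
    (\<Sum>s\<in>Pow (edges G).
      (\<Prod>n::nat. theta (bouquet n) 1 \<gamma> ^ num_components_nullity (spanning_subgraph G s) n)
      * (\<Prod>e\<in>s. \<beta> e) * (\<Prod>e\<in>edges G - s. 1 - \<beta> e))"
proof -
  interpret finite_multigraph G by fact
  let ?F = "\<lambda>t. \<Prod>v\<in>verts G. deg_poly (degree (spanning_subgraph G t) v) \<gamma>"
  \<comment> \<open>The inner sum is \<open>Theta\<close> of (V, s) at edge weights 1, so the
    results on components apply to that graph in place of G.\<close>
  have F: "(\<Sum>t\<in>Pow s. ?F t)
      = (\<Prod>n::nat. theta (bouquet n) 1 \<gamma> ^ num_components_nullity (spanning_subgraph G s) n)"
    if "s \<subseteq> edges G" for s
  proof -
    interpret S: finite_multigraph "spanning_subgraph G s"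
      by (rule finite_multigraph_spanning_subgraph[OF that])
    have "spanning_subgraph (spanning_subgraph G s) t = spanning_subgraph G t"
      and "verts (spanning_subgraph G s) = verts G" "edges (spanning_subgraph G s) = s" for t
      by (simp_all add: spanning_subgraph_def)
    then show ?thesis
      using S.sum_deg_poly_eq_prod_components(2)[of \<gamma>]
        S.Prod_any_num_components_nullity[of "\<lambda>n. theta (bouquet n) 1 \<gamma>"] by simp
  qed
  have "Theta G \<beta> (\<lambda>_. \<gamma>) = (\<Sum>t\<in>Pow (edges G). (\<Prod>e\<in>t. \<beta> e) * ?F t)"
    by (simp add: Theta_def spanning_subgraph_def)
  also have "\<dots> = (\<Sum>s\<in>Pow (edges G).
      (\<Sum>t\<in>Pow s. ?F t) * (\<Prod>e\<in>s. \<beta> e) * (\<Prod>e\<in>edges G - s. 1 - \<beta> e))"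
    by (rule sum_Pow_prod_complement[OF finite_edges])
  finally show ?thesis using F by simp
qed

end
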